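(* Let $G$ be a finitely generated hyperbolic group with a fixed finite symmetric generating set $S$, and let $\delta\ge 0$, $\delta\in\frac12\mathbb Z$, be such that $G$ is $\delta$-hyperbolic with respect to $S$. Let $$\eta=\frac{1}{4\,|B_{4\delta+\varepsilon}|\,|B_{4\delta}|},$$ where $\varepsilon=0$ if the Cayley graph $\Gamma(G,S)$ is bipartite and $\varepsilon=1$ otherwise. If $n,k\ge0$ are integers and $U\subseteq S_n$ and $V\subseteq S_k$ are finite non-empty sets, then $$|UV|\ge\eta\,|U||V|.$$
   Context: $d$ is the word metric on $G$ with respect to $S$, $|g|=d(1,g)$, $B_m=\{g\in G:|g|\le m\}$, $S_m=\{g\in G:|g|=m\}$, and $UV=\{uv:u\in U,v\in V\}$. The Gromov product is $(x\mid y)_t=\frac12(d(x,t)+d(y,t)-d(x,y))$ for $x,y,t\in G$. The group $G$ is $\delta$-hyperbolic with respect to $S$ if $(x\mid z)_t\ge\min\{(x\mid y)_t,(y\mid z)_t\}-\delta$ for all $x,y,z,t\in G$. *)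

theory Defs
  imports Complex_Main "HOL-Algebra.Coset" "HOL-Algebra.Generated_Groups"
begin

definition word_val :: "('a, 'b) monoid_scheme \<Rightarrow> 'a list \<Rightarrow> 'a"
  where "word_val G ws = foldr (\<lambda>s g. s \<otimes>\<^bsub>G\<^esub> g) ws \<one>\<^bsub>G\<^esub>"

text \<open>
  The left-invariant word metric, i.e. the path metric of the Cayley graph whose edges are
  \<open>{g, g s}\<close>. The \<open>LEAST\<close> is meaningful when the symmetric set \<open>S\<close> generates \<open>G\<close> and both
  points lie in the carrier.
\<close>

definition word_dist :: "('a, 'b) monoid_scheme \<Rightarrow> 'a set \<Rightarrow> 'a \<Rightarrow> 'a \<Rightarrow> nat"
  where "word_dist G S x y =
    (LEAST n. \<exists>ws. set ws \<subseteq> S \<and> length ws = n \<and> y = x \<otimes>\<^bsub>G\<^esub> word_val G ws)"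

definition word_norm :: "('a, 'b) monoid_scheme \<Rightarrow> 'a set \<Rightarrow> 'a \<Rightarrow> nat"
  where "word_norm G S g = word_dist G S \<one>\<^bsub>G\<^esub> g"

text \<open>The radius is real so that \<open>4 * \<delta>\<close> can be used without coercion.\<close>

definition word_ball :: "('a, 'b) monoid_scheme \<Rightarrow> 'a set \<Rightarrow> real \<Rightarrow> 'a set"
  where "word_ball G S r = {g \<in> carrier G. real (word_norm G S g) \<le> r}"

definition word_sphere :: "('a, 'b) monoid_scheme \<Rightarrow> 'a set \<Rightarrow> nat \<Rightarrow> 'a set"
  where "word_sphere G S n = {g \<in> carrier G. word_norm G S g = n}"

definition gromov_product :: "('a, 'b) monoid_scheme \<Rightarrow> 'a set \<Rightarrow> 'a \<Rightarrow> 'a \<Rightarrow> 'a \<Rightarrow> real"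
  where "gromov_product G S x y t =
    (real (word_dist G S x t) + real (word_dist G S y t) - real (word_dist G S x y)) / 2"

definition hyperbolic_wrt :: "('a, 'b) monoid_scheme \<Rightarrow> 'a set \<Rightarrow> real \<Rightarrow> bool"
  where "hyperbolic_wrt G S \<delta> \<longleftrightarrow>
    (\<forall>x \<in> carrier G. \<forall>y \<in> carrier G. \<forall>z \<in> carrier G. \<forall>t \<in> carrier G.
      gromov_product G S x z t \<ge> min (gromov_product G S x y t) (gromov_product G S y z t) - \<delta>)"

text \<open>
  The Cayley graph is taken without loops: if \<open>\<one> \<in> S\<close>, this generator contributes no edge. Loops
  do not affect the word metric, but would destroy bipartiteness.
\<close>

definition cayley_adj :: "('a, 'b) monoid_scheme \<Rightarrow> 'a set \<Rightarrow> 'a \<Rightarrow> 'a \<Rightarrow> bool"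
  where "cayley_adj G S x y \<longleftrightarrow>
    x \<in> carrier G \<and> y \<in> carrier G \<and> x \<noteq> y \<and> (\<exists>s \<in> S. y = x \<otimes>\<^bsub>G\<^esub> s)"

definition bipartite_graph :: "'a set \<Rightarrow> ('a \<Rightarrow> 'a \<Rightarrow> bool) \<Rightarrow> bool"
  where "bipartite_graph V adj \<longleftrightarrow>
    (\<exists>A B. A \<union> B = V \<and> A \<inter> B = {} \<and>
      (\<forall>x \<in> V. \<forall>y \<in> V. adj x y \<longrightarrow> (x \<in> A \<and> y \<in> B) \<or> (x \<in> B \<and> y \<in> A)))"

definition cayley_parity :: "('a, 'b) monoid_scheme \<Rightarrow> 'a set \<Rightarrow> real"
  where "cayley_parity G S = (if bipartite_graph (carrier G) (cayley_adj G S) then 0 else 1)"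

definition growth_const :: "('a, 'b) monoid_scheme \<Rightarrow> 'a set \<Rightarrow> real \<Rightarrow> real"
  where "growth_const G S \<delta> =
    1 / (4 * real (card (word_ball G S (4 * \<delta> + cayley_parity G S)))
           * real (card (word_ball G S (4 * \<delta>))))"

end

theory Submission
  imports Defs
begin

text \<open>
  The idea is best seen in a tree, where \<open>\<delta> = 0\<close>. Write \<open>u = x a\<close> and \<open>v = a\<inverse> y\<close>, where \<open>a\<close> is the
  part that cancels in \<open>u v = x y\<close>. The product and its length determine \<open>x\<close>, \<open>y\<close> and the length \<open>i\<close>
  of \<open>a\<close>, but not \<open>a\<close> itself, so a product may have many factorisations. They become unique once
  \<open>a\<close> is required to be a suffix of one fixed word \<open>u\<^sub>0\<close>. This holds as soon as \<open>u\<^sub>0 v\<close> cancels at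
  least as much as \<open>u v\<close>, that is, if \<open>|u\<^sub>0 v| \<le> |u v|\<close>, because \<open>u\<^sub>0\<close> and \<open>u\<close>
  have the same length. Since the roles of \<open>u\<^sub>0\<close> and \<open>u\<close> in this condition are symmetric, some \<open>u\<^sub>0 \<in> U\<close> satisfies it for at least half of all pairs \<open>(u, v)\<close>
  (\<open>popular_lower_bound\<close>). These pairs have different products, hence \<open>|U| |V| \<le> 2 |U V|\<close>.

  In a \<open>\<delta>\<close>-hyperbolic group the prefix \<open>x\<close> is replaced by a point \<open>p\<close> at distance \<open>n - i\<close> from \<open>\<one>\<close>
  on a geodesic to \<open>u v\<close>, and \<open>a\<inverse>\<close> by a point \<open>c\<close> at distance \<open>i\<close> from \<open>\<one>\<close> on a geodesic to \<open>u\<^sub>0\<inverse>\<close>.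
  Four uses of the four-point inequality show that \<open>u c\<close> lies close to \<open>p\<close> (\<open>near_tripod_point\<close>).
  So \<open>u = p b c\<inverse>\<close> with \<open>b\<close> in a ball whose radius is at most \<open>8 \<delta> + \<epsilon>\<close>. The rounding error in
  \<open>i = \<lfloor>(n + k - |u v|) / 2\<rfloor>\<close> accounts for \<open>\<epsilon>\<close>; it vanishes in a bipartite graph by parity.
  Finally that ball is covered by the product of the balls of radii \<open>4 \<delta> + \<epsilon>\<close> and \<open>4 \<delta>\<close>. The
  argument loses a factor \<open>2\<close> only, so it proves the bound with room to spare.
\<close>

section \<open>Word metrics\<close>

locale symmetric_generators = group G for G (structure) +
  fixes S :: "'a set"
  assumes S_carrier: "S \<subseteq> carrier G"
    and S_inv: "\<And>s. s \<in> S \<Longrightarrow> inv s \<in> S"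
    and S_generates: "generate G S = carrier G"
begin

abbreviation d :: "'a \<Rightarrow> 'a \<Rightarrow> nat"
  where "d \<equiv> word_dist G S"

lemma word_val_Nil [simp]: "word_val G [] = \<one>"
  and word_val_Cons [simp]: "word_val G (s # ws) = s \<otimes> word_val G ws"
  by (simp_all add: word_val_def)

lemma word_val_closed [simp]: "set ws \<subseteq> S \<Longrightarrow> word_val G ws \<in> carrier G"
  using S_carrier by (induction ws) auto

lemma word_val_append:
  "set ws \<subseteq> S \<Longrightarrow> set vs \<subseteq> S \<Longrightarrow> word_val G (ws @ vs) = word_val G ws \<otimes> word_val G vs"
proof (induction ws)
  case (Cons s ws)
  then have "s \<in> carrier G" using S_carrier by auto
  with Cons show ?case by (simp add: m_assoc)
qed simp

lemma inverse_word:
  "set ws \<subseteq> S \<Longrightarrow> \<exists>vs. set vs \<subseteq> S \<and> length vs = length ws \<and> word_val G vs = inv (word_val G ws)"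
proof (induction ws)
  case (Cons s ws)
  then obtain vs where vs: "set vs \<subseteq> S" "length vs = length ws"
      "word_val G vs = inv (word_val G ws)"
    by auto
  have s: "s \<in> S" "s \<in> carrier G" using Cons.prems S_carrier by auto
  have "word_val G (vs @ [inv s]) = inv (word_val G (s # ws))"
    using vs s Cons.prems S_inv by (subst word_val_append) (auto simp: inv_mult_group)
  then show ?case
    using vs s S_inv by (intro exI[of _ "vs @ [inv s]"]) auto
qed auto

lemma word_exists:
  assumes "g \<in> carrier G"
  shows "\<exists>ws. set ws \<subseteq> S \<and> word_val G ws = g"
proof -
  have "g \<in> generate G S" using assms S_generates by simp
  then show ?thesis
  proof (induction rule: generate.induct)
    case one
    show ?case by (rule exI[of _ "[]"]) simp
  next
    case (incl h)
    then show ?case using S_carrier by (intro exI[of _ "[h]"]) auto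
  next
    case (inv h)
    then show ?case using S_carrier S_inv by (intro exI[of _ "[inv h]"]) auto
  next
    case (eng g h)
    then show ?case by (metis word_val_append set_append Un_subset_iff)
  qed
qed

lemma geodesic_word:
  assumes "x \<in> carrier G" "y \<in> carrier G"
  shows "\<exists>ws. set ws \<subseteq> S \<and> length ws = d x y \<and> y = x \<otimes> word_val G ws"
proof -
  obtain ws where "set ws \<subseteq> S" "word_val G ws = inv x \<otimes> y"
    using word_exists assms by (meson inv_closed m_closed)
  then have "\<exists>n ws. set ws \<subseteq> S \<and> length ws = n \<and> y = x \<otimes> word_val G ws"
    using assms by (metis inv_closed inv_solve_left m_closed)
  from LeastI_ex[OF this] show ?thesis unfolding word_dist_def .
qed

lemma dist_le_length:
  "set ws \<subseteq> S \<Longrightarrow> y = x \<otimes> word_val G ws \<Longrightarrow> d x y \<le> length ws"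
  unfolding word_dist_def by (rule Least_le) blast

lemma dist_translate:
  assumes "g \<in> carrier G" "x \<in> carrier G" "y \<in> carrier G"
  shows "d (g \<otimes> x) (g \<otimes> y) = d x y"
proof -
  have "g \<otimes> y = g \<otimes> x \<otimes> word_val G ws \<longleftrightarrow> y = x \<otimes> word_val G ws" if "set ws \<subseteq> S" for ws
    using assms that by (simp add: m_assoc)
  then show ?thesis unfolding word_dist_def by (metis (no_types, lifting))
qed

lemma dist_commute:
  assumes "x \<in> carrier G" "y \<in> carrier G"
  shows "d x y = d y x"
proof -
  have "d y x \<le> d x y" if xy: "x \<in> carrier G" "y \<in> carrier G" for x y
  proof -
    obtain ws where ws: "set ws \<subseteq> S" "length ws = d x y" "y = x \<otimes> word_val G ws"
      using geodesic_word[OF xy] by auto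
    obtain vs where vs: "set vs \<subseteq> S" "length vs = length ws"
        "word_val G vs = inv (word_val G ws)"
      using inverse_word[OF ws(1)] by auto
    have "x = y \<otimes> word_val G vs" using ws vs xy by (simp add: m_assoc)
    then show ?thesis using dist_le_length vs ws by metis
  qed
  with assms show ?thesis by (simp add: le_antisym)
qed

lemma dist_triangle:
  assumes "x \<in> carrier G" "y \<in> carrier G" "z \<in> carrier G"
  shows "d x z \<le> d x y + d y z"
proof -
  obtain ws where ws: "set ws \<subseteq> S" "length ws = d x y" "y = x \<otimes> word_val G ws"
    using geodesic_word assms by meson
  obtain vs where vs: "set vs \<subseteq> S" "length vs = d y z" "z = y \<otimes> word_val G vs"
    using geodesic_word assms by meson
  have "z = x \<otimes> word_val G (ws @ vs)" using ws vs assms by (simp add: word_val_append m_assoc)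
  then show ?thesis using dist_le_length[of "ws @ vs" z x] ws vs by simp
qed

lemma dist_self: "x \<in> carrier G \<Longrightarrow> d x x = 0"
  using dist_le_length[of "[]" x x] by simp

lemma dist_eq_0: "x \<in> carrier G \<Longrightarrow> y \<in> carrier G \<Longrightarrow> d x y = 0 \<Longrightarrow> x = y"
  using geodesic_word[of x y] by auto

lemma geodesic_point:
  assumes "x \<in> carrier G" "y \<in> carrier G" "m \<le> d x y"
  shows "\<exists>p \<in> carrier G. d x p = m \<and> d p y = d x y - m"
proof -
  obtain ws where ws: "set ws \<subseteq> S" "length ws = d x y" "y = x \<otimes> word_val G ws"
    using geodesic_word assms by meson
  have sub: "set (take m ws) \<subseteq> S" "set (drop m ws) \<subseteq> S"
    using ws(1) set_take_subset[of m ws] set_drop_subset[of m ws] by auto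
  define p where "p = x \<otimes> word_val G (take m ws)"
  have p: "p \<in> carrier G" using sub assms by (simp add: p_def)
  have "word_val G ws = word_val G (take m ws) \<otimes> word_val G (drop m ws)"
    using word_val_append[OF sub] by simp
  then have "y = p \<otimes> word_val G (drop m ws)"
    using ws(3) m_assoc[OF assms(1) word_val_closed[OF sub(1)] word_val_closed[OF sub(2)]]
    by (simp only: p_def)
  from dist_le_length[OF sub(2) this] have "d p y \<le> d x y - m" by (simp add: ws(2))
  moreover from dist_le_length[OF sub(1) p_def] have "d x p \<le> m" by simp
  moreover have "d x y \<le> d x p + d p y" by (rule dist_triangle) (use p assms in auto)
  ultimately show ?thesis using p assms(3) by (intro bexI[of _ p]) auto
qed

lemma finite_word_ball:
  assumes "finite S"
  shows "finite (word_ball G S r)"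
proof (rule finite_subset)
  show "word_ball G S r \<subseteq> word_val G ` {ws. set ws \<subseteq> S \<and> length ws \<le> nat \<lfloor>r\<rfloor>}"
  proof
    fix g assume g: "g \<in> word_ball G S r"
    then have gc: "g \<in> carrier G" and "real (d \<one> g) \<le> r"
      by (auto simp: word_ball_def word_norm_def)
    then have "d \<one> g \<le> nat \<lfloor>r\<rfloor>" by linarith
    moreover obtain ws where ws: "set ws \<subseteq> S" "length ws = d \<one> g" "g = \<one> \<otimes> word_val G ws"
      using geodesic_word[OF one_closed gc] by blast
    moreover have "g = word_val G ws" using ws by simp
    ultimately show "g \<in> word_val G ` {ws. set ws \<subseteq> S \<and> length ws \<le> nat \<lfloor>r\<rfloor>}"
      by (intro image_eqI[of _ _ ws]) simp_all
  qed
  show "finite (word_val G ` {ws. set ws \<subseteq> S \<and> length ws \<le> nat \<lfloor>r\<rfloor>})"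
    using finite_lists_length_le[OF assms] by simp
qed

lemma card_word_ball_pos:
  assumes "finite S" "r \<ge> 0"
  shows "card (word_ball G S r) > 0"
proof -
  have "\<one> \<in> word_ball G S r"
    using \<open>r \<ge> 0\<close> by (simp add: word_ball_def word_norm_def dist_self)
  then show ?thesis using finite_word_ball[OF \<open>finite S\<close>] card_gt_0_iff by blast
qed

text \<open>
  Cutting a geodesic at distance \<open>a\<close> from \<open>\<one>\<close> covers a ball by a product of two balls. The radius
  \<open>a\<close> must be an integer for such a point to exist.
\<close>

lemma card_word_ball_add:
  assumes fin: "finite S" and "b \<ge> 0"
  shows "card (word_ball G S (real a + b)) \<le> card (word_ball G S (real a)) * card (word_ball G S b)"
proof -
  let ?A = "word_ball G S (real a)" and ?B = "word_ball G S b"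
  have "word_ball G S (real a + b) \<subseteq> (\<lambda>(g, h). g \<otimes> h) ` (?A \<times> ?B)"
  proof
    fix g assume "g \<in> word_ball G S (real a + b)"
    then have g: "g \<in> carrier G" "real (d \<one> g) \<le> real a + b"
      by (auto simp: word_ball_def word_norm_def)
    obtain p where p: "p \<in> carrier G" "d \<one> p = min a (d \<one> g)" "d p g = d \<one> g - min a (d \<one> g)"
      using geodesic_point[OF one_closed g(1), of "min a (d \<one> g)"] by auto
    have "d \<one> (inv p \<otimes> g) = d p g"
      using dist_translate[of "inv p" p g] p g by simp
    moreover have "real (d p g) \<le> b" using p g \<open>b \<ge> 0\<close> by (auto simp: min_def)
    ultimately have "inv p \<otimes> g \<in> ?B"
      using p g by (simp add: word_ball_def word_norm_def)
    moreover have "p \<in> ?A" using p by (simp add: word_ball_def word_norm_def)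
    moreover have "g = p \<otimes> (inv p \<otimes> g)" using p g by (simp add: m_assoc[symmetric])
    ultimately show "g \<in> (\<lambda>(g, h). g \<otimes> h) ` (?A \<times> ?B)" by force
  qed
  then have "card (word_ball G S (real a + b)) \<le> card (?A \<times> ?B)"
    by (rule surj_card_le[rotated]) (simp add: finite_word_ball fin)
  then show ?thesis by (simp add: card_cartesian_product)
qed

section \<open>Parity in bipartite Cayley graphs\<close>

text \<open>
  Consecutive points of a geodesic are distinct, so they are joined by an edge of the loop-free
  Cayley graph even if \<open>\<one> \<in> S\<close>. Hence each step of a geodesic changes sides.
\<close>

lemma dist_parity:
  assumes edges: "\<And>x y. cayley_adj G S x y \<Longrightarrow> x \<in> A \<longleftrightarrow> y \<notin> A"
    and "x \<in> carrier G" "y \<in> carrier G"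
  shows "even (d x y) \<longleftrightarrow> (x \<in> A \<longleftrightarrow> y \<in> A)"
  using \<open>y \<in> carrier G\<close>
proof (induction "d x y" arbitrary: y)
  case 0
  then show ?case using dist_eq_0[of x y] \<open>x \<in> carrier G\<close> by auto
next
  case (Suc m)
  have D: "d x y = Suc m" using Suc.hyps(2) by (rule sym)
  obtain p where p: "p \<in> carrier G" "d x p = m" "d p y = 1"
    using geodesic_point[OF \<open>x \<in> carrier G\<close> Suc.prems, of m] D by auto
  obtain ws where ws: "set ws \<subseteq> S" "length ws = 1" "y = p \<otimes> word_val G ws"
    using geodesic_word[OF p(1) Suc.prems] p(3) by auto
  then obtain s where s: "ws = [s]" "s \<in> S" by (auto simp: length_Suc_conv)
  then have "y = p \<otimes> s" using ws S_carrier by auto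
  moreover have "p \<noteq> y" using p(1,3) dist_self[of p] by auto
  ultimately have "cayley_adj G S p y"
    using p s Suc.prems by (auto simp: cayley_adj_def)
  then have "p \<in> A \<longleftrightarrow> y \<notin> A" by (rule edges)
  moreover have "even (d x p) \<longleftrightarrow> (x \<in> A \<longleftrightarrow> p \<in> A)"
    by (rule Suc.hyps(1)[OF p(2)[symmetric] p(1)])
  moreover have "even (d x y) \<longleftrightarrow> odd (d x p)"
    by (simp add: D p(2))
  ultimately show ?case by argo
qed

lemma bipartite_perimeter_even:
  assumes "bipartite_graph (carrier G) (cayley_adj G S)"
    and "x \<in> carrier G" "y \<in> carrier G" "z \<in> carrier G"
  shows "even (d x y + d y z + d x z)"
proof -
  obtain A B where AB: "A \<inter> B = {}" "\<forall>x \<in> carrier G. \<forall>y \<in> carrier G.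
      cayley_adj G S x y \<longrightarrow> (x \<in> A \<and> y \<in> B) \<or> (x \<in> B \<and> y \<in> A)"
    using assms(1) unfolding bipartite_graph_def by metis
  have sides: "x \<in> A \<longleftrightarrow> y \<notin> A" if "cayley_adj G S x y" for x y
  proof -
    have "x \<in> carrier G" "y \<in> carrier G" using that by (auto simp: cayley_adj_def)
    then show ?thesis using AB that by blast
  qed
  have parity: "even (d a b) \<longleftrightarrow> (a \<in> A \<longleftrightarrow> b \<in> A)"
    if "a \<in> carrier G" "b \<in> carrier G" for a b
    by (rule dist_parity[where A = A]) (fact sides that)+
  show ?thesis
    unfolding even_add parity[OF assms(2,3)] parity[OF assms(3,4)] parity[OF assms(2,4)] by argo
qed

section \<open>Hyperbolicity\<close>

lemma four_point:
  assumes "hyperbolic_wrt G S \<delta>"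
    and "x \<in> carrier G" "y \<in> carrier G" "z \<in> carrier G" "t \<in> carrier G"
  shows "real (d x z) + real (d y t)
    \<le> max (real (d x y) + real (d z t)) (real (d y z) + real (d x t)) + 2 * \<delta>"
proof -
  have "gromov_product G S x z t
      \<ge> min (gromov_product G S x y t) (gromov_product G S y z t) - \<delta>"
    using assms unfolding hyperbolic_wrt_def by blast
  then show ?thesis unfolding gromov_product_def by argo
qed

text \<open>
  The triangle \<open>x, u, w\<close> is thin and branches at distance about \<open>i\<close> from \<open>u\<close>. As \<open>z\<close> is as far
  from \<open>u\<close> as \<open>x\<close> is, but at least as close to \<open>w\<close>, the geodesic from \<open>u\<close> to \<open>z\<close> follows the
  common part up to the branch point. So its point \<open>q\<close> at distance \<open>i\<close> is near the point \<open>p\<close> of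
  the geodesic from \<open>x\<close> to \<open>w\<close>. The number \<open>e\<close> bounds the error of rounding \<open>2 i\<close>.
\<close>

lemma near_tripod_point:
  assumes hyp: "hyperbolic_wrt G S \<delta>" and "\<delta> \<ge> 0" and "e \<ge> 0"
    and car: "x \<in> carrier G" "u \<in> carrier G" "w \<in> carrier G" "z \<in> carrier G"
      "p \<in> carrier G" "q \<in> carrier G"
    and z: "d u z = d x u" "d z w \<le> d x w"
    and i: "2 * i + d x w \<le> d x u + d u w" "real (d x u + d u w) \<le> real (2 * i + d x w) + e"
    and q: "real (d u q) = i" "real (d q z) = real (d u z) - i"
    and p: "real (d x p) = real (d x u) - i" "real (d p w) = real (d x w) - (real (d x u) - i)"
  shows "real (d p q) \<le> 8 * \<delta> + e"
proof -
  have sym: "d a b = d b a" if "a \<in> carrier G" "b \<in> carrier G" for a b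
    using dist_commute that .
  note i' = i[folded of_nat_le_iff[where 'a = real]]
  have xz: "real (d x z) \<le> real (d x u) + real (d x w) - real (d u w) + 2 * \<delta>"
    using four_point[OF hyp, of x u z w] car z by (auto simp: max_def split: if_splits)
  have xq: "real (d x q) \<le> real (d x u) - i + 4 * \<delta>"
    using four_point[OF hyp, of x u q z] car z q xz i' \<open>\<delta> \<ge> 0\<close>
    by (auto simp: max_def split: if_splits)
  have wq: "real (d q w) \<le> real (d u w) - i + 2 * \<delta>"
    using four_point[OF hyp, of w u q z] car z q i' sym[of w u] sym[of w z] sym[of w q]
    by (auto simp: max_def split: if_splits)
  show ?thesis
    using four_point[OF hyp, of p x q w] car p xq wq i' sym[of p x] \<open>\<delta> \<ge> 0\<close> \<open>e \<ge> 0\<close>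
    by (auto simp: max_def split: if_splits)
qed

section \<open>Products of subsets of spheres\<close>

text \<open>
  All factorisations \<open>w = u v\<close> in which \<open>v\<close> cancels against \<open>u\<^sub>0\<close> at least as much as against \<open>u\<close>
  have the form \<open>u = p b c\<inverse>\<close>, where \<open>p\<close> and \<open>c\<close> depend on \<open>u\<^sub>0\<close> and \<open>w\<close> only and \<open>b\<close> is short.
\<close>

lemma card_factorisations:
  assumes "finite S" and hyp: "hyperbolic_wrt G S \<delta>" and "\<delta> \<ge> 0"
    and u0: "u0 \<in> word_sphere G S n" and w: "w \<in> carrier G"
  shows "card {u \<in> word_sphere G S n. \<exists>v \<in> word_sphere G S k.
      u \<otimes> v = w \<and> word_norm G S (u0 \<otimes> v) \<le> word_norm G S w}
    \<le> card (word_ball G S (8 * \<delta> + cayley_parity G S))"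
    (is "card ?F \<le> card ?B")
proof (cases "?F = {}")
  case False
  define i where "i = (n + k - d \<one> w) div 2"
  let ?e = "cayley_parity G S"
  have sphere: "g \<in> carrier G" "d \<one> g = m" if "g \<in> word_sphere G S m" for g m
    using that by (auto simp: word_sphere_def word_norm_def)
  have triangle: "d \<one> u = n" "d u w = k" if "u \<in> word_sphere G S n" "v \<in> word_sphere G S k"
      "u \<otimes> v = w" for u v
    using sphere[OF that(1)] sphere[OF that(2)] dist_translate[of u \<one> v] that(3) by auto
  obtain u1 v1 where u1: "u1 \<in> word_sphere G S n" "v1 \<in> word_sphere G S k" "u1 \<otimes> v1 = w"
    using False by auto
  note t1 = triangle[OF u1] and u1c = sphere(1)[OF u1(1)]
  have tri: "d \<one> w \<le> n + k" "k \<le> n + d \<one> w" "n \<le> d \<one> w + k"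
    using dist_triangle[of \<one> u1 w] dist_triangle[of u1 \<one> w] dist_triangle[of \<one> w u1]
      t1 u1c w dist_commute[of u1 \<one>] dist_commute[of u1 w] by auto
  have i: "i \<le> n" "n - i \<le> d \<one> w" "2 * i + d \<one> w \<le> n + k"
    using tri by (auto simp: i_def)
  have rounding: "real (n + k) \<le> real (2 * i + d \<one> w) + ?e"
  proof (cases "bipartite_graph (carrier G) (cayley_adj G S)")
    case True
    then have "even (n + k + d \<one> w)"
      using bipartite_perimeter_even[OF True one_closed u1c w] t1 by simp
    then have "even (n + k - d \<one> w)" using tri by (metis even_diff_nat)
    then have "2 * i = n + k - d \<one> w" by (simp add: i_def)
    then have "n + k = 2 * i + d \<one> w" using tri by simp
    then show ?thesis by (simp add: cayley_parity_def)
  next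
    case nonbip: False
    have "n + k \<le> 2 * i + d \<one> w + 1" by (auto simp: i_def)
    then have "real (n + k) \<le> real (2 * i + d \<one> w + 1)" by (rule of_nat_mono)
    then show ?thesis using nonbip by (simp add: cayley_parity_def)
  qed
  have u0c: "u0 \<in> carrier G" "d \<one> (inv u0) = n"
    using sphere[OF u0] dist_translate[of u0 \<one> "inv u0"] dist_commute[of u0 \<one>] by auto
  obtain c where c: "c \<in> carrier G" "d \<one> c = i" "d c (inv u0) = n - i"
    using geodesic_point[of \<one> "inv u0" i] u0c i by auto
  obtain p where p: "p \<in> carrier G" "d \<one> p = n - i" "d p w = d \<one> w - (n - i)"
    using geodesic_point[of \<one> w "n - i"] w i by auto
  have "?F \<subseteq> (\<lambda>b. p \<otimes> b \<otimes> inv c) ` ?B"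
  proof
    fix u assume "u \<in> ?F"
    then obtain v where uv: "u \<in> word_sphere G S n" "v \<in> word_sphere G S k" "u \<otimes> v = w"
        and closer: "d \<one> (u0 \<otimes> v) \<le> d \<one> w"
      by (auto simp: word_norm_def)
    note t = triangle[OF uv]
    have uc: "u \<in> carrier G" "v \<in> carrier G" using sphere uv by auto
    have z: "d u (u \<otimes> inv u0) = n" "d (u \<otimes> inv u0) w \<le> d \<one> w"
    proof -
      show "d u (u \<otimes> inv u0) = n"
        using dist_translate[of u \<one> "inv u0"] uc u0c by simp
      have "d (u \<otimes> inv u0) w = d (inv u0) v"
        using dist_translate[of u "inv u0" v] uc u0c uv(3) by simp
      also have "\<dots> = d \<one> (u0 \<otimes> v)"
        using dist_translate[of u0 "inv u0" v] uc u0c by simp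
      finally show "d (u \<otimes> inv u0) w \<le> d \<one> w" using closer by simp
    qed
    have q: "d u (u \<otimes> c) = i" "d (u \<otimes> c) (u \<otimes> inv u0) = n - i"
      using dist_translate[of u \<one> c] dist_translate[of u c "inv u0"] uc c u0c by auto
    define b where "b = inv p \<otimes> (u \<otimes> c)"
    have "real (d p (u \<otimes> c)) \<le> 8 * \<delta> + ?e"
      by (rule near_tripod_point[OF hyp \<open>\<delta> \<ge> 0\<close>, where x = \<one> and u = u and w = w
              and z = "u \<otimes> inv u0" and i = i])
        (use uc u0c c p w z q t i rounding in \<open>auto simp: cayley_parity_def of_nat_diff\<close>)
    moreover have "d \<one> b = d p (u \<otimes> c)"
      using dist_translate[of "inv p" p "u \<otimes> c"] p uc c by (simp add: b_def)
    ultimately have "b \<in> ?B"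
      using p uc c by (simp add: word_ball_def word_norm_def b_def)
    moreover have "p \<otimes> b = u \<otimes> c"
      using p uc c by (simp add: b_def m_assoc[symmetric])
    then have "u = p \<otimes> b \<otimes> inv c"
      using uc c by (simp add: m_assoc)
    ultimately show "u \<in> (\<lambda>b. p \<otimes> b \<otimes> inv c) ` ?B" by blast
  qed
  then show ?thesis
    by (rule surj_card_le[OF finite_word_ball[OF \<open>finite S\<close>]])
qed (simp only: card.empty le0)

end

text \<open>
  Exchanging \<open>a\<close> and \<open>a'\<close> maps the triples \<open>(a, a', b)\<close> with \<open>f a b \<le> f a' b\<close> onto those with
  \<open>f a' b \<le> f a b\<close>. Since every triple satisfies one of the two conditions, at least half of all
  triples satisfy the first one, and some \<open>a\<close> does at least as well as the average.
\<close>

lemma popular_lower_bound: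
  fixes f :: "'a \<Rightarrow> 'b \<Rightarrow> 'c::linorder"
  assumes fin: "finite A" "finite B" and "A \<noteq> {}"
  shows "\<exists>a \<in> A. card A * card B \<le> 2 * card {(a', b) \<in> A \<times> B. f a b \<le> f a' b}"
proof (rule ccontr)
  assume "\<not> ?thesis"
  then have less: "2 * card {(a', b) \<in> A \<times> B. f a b \<le> f a' b} < card A * card B" if "a \<in> A" for a
    using that by force
  define P where "P = (SIGMA a:A. {(a', b) \<in> A \<times> B. f a b \<le> f a' b})"
  define Q where "Q = (\<lambda>(a, a', b). (a', a, b)) ` P"
  have finP: "finite P" unfolding P_def
    by (intro finite_SigmaI fin finite_subset[of _ "A \<times> B"]) (auto simp: fin)
  have "card (A \<times> A \<times> B) \<le> card (P \<union> Q)"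
  proof (rule card_mono)
    show "A \<times> A \<times> B \<subseteq> P \<union> Q"
    proof
      fix t assume "t \<in> A \<times> A \<times> B"
      then obtain a a' b where t: "t = (a, a', b)" "a \<in> A" "a' \<in> A" "b \<in> B" by auto
      show "t \<in> P \<union> Q"
      proof (cases "f a b \<le> f a' b")
        case True
        with t show ?thesis by (simp add: P_def)
      next
        case False
        with t have "(a', a, b) \<in> P" by (auto simp: P_def)
        with t show ?thesis by (force simp: Q_def)
      qed
    qed
  qed (use finP Q_def in auto)
  also have "\<dots> \<le> card P + card Q" by (rule card_Un_le)
  also have "card Q \<le> card P" unfolding Q_def by (rule card_image_le[OF finP])
  finally have "card A * (card A * card B) \<le> 2 * card P" by (simp add: card_cartesian_product)
  also have "2 * card P = (\<Sum>a \<in> A. 2 * card {(a', b) \<in> A \<times> B. f a b \<le> f a' b})"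
    unfolding P_def sum_distrib_left[symmetric]
    by (subst card_SigmaI) (auto intro: fin finite_subset[of _ "A \<times> B"])
  also have "\<dots> < (\<Sum>a \<in> A. card A * card B)"
    by (rule sum_strict_mono) (use fin \<open>A \<noteq> {}\<close> less in auto)
  finally show False by simp
qed

text \<open>
  For a popular \<open>u\<^sub>0\<close>, at least half of \<open>U \<times> V\<close> is spread over the fibres that
  \<open>card_factorisations\<close> bounds.
\<close>

lemma (in symmetric_generators) card_set_mult_spheres:
  assumes finS: "finite S" and hyp: "hyperbolic_wrt G S \<delta>" and "\<delta> \<ge> 0"
    and U: "U \<subseteq> word_sphere G S n" "finite U" "U \<noteq> {}"
    and V: "V \<subseteq> word_sphere G S k" "finite V"
  shows "card U * card V
    \<le> 2 * (card (word_ball G S (8 * \<delta> + cayley_parity G S)) * card (U <#> V))"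
proof -
  let ?N = "word_norm G S" and ?B = "word_ball G S (8 * \<delta> + cayley_parity G S)"
  obtain u0 where u0: "u0 \<in> U"
    and half: "card U * card V \<le> 2 * card {(u, v) \<in> U \<times> V. ?N (u0 \<otimes> v) \<le> ?N (u \<otimes> v)}"
    using popular_lower_bound[OF U(2) V(2) U(3), of "\<lambda>u v. ?N (u \<otimes> v)"] by auto
  define P where "P = {(u, v) \<in> U \<times> V. ?N (u0 \<otimes> v) \<le> ?N (u \<otimes> v)}"
  have finP: "finite P"
    by (rule finite_subset[of _ "U \<times> V"]) (use U V in \<open>auto simp: P_def\<close>)
  have sphere_carrier: "word_sphere G S m \<subseteq> carrier G" for m
    by (auto simp: word_sphere_def)
  have finUV: "finite (U <#> V)" using U V by (simp add: set_mult_def)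
  \<comment> \<open>Pairs in \<open>P\<close> are counted by their product \<open>w\<close>; such a pair is determined by \<open>u \<in> F w\<close>.\<close>
  define F where "F = (\<lambda>w. {u \<in> word_sphere G S n. \<exists>v \<in> word_sphere G S k.
      u \<otimes> v = w \<and> ?N (u0 \<otimes> v) \<le> ?N w} \<inter> U)"
  have "v = v'" if "(u, v) \<in> P" "(u, v') \<in> P" "u \<otimes> v = u \<otimes> v'" for u v v'
  proof -
    have "u \<in> carrier G" "v \<in> carrier G" "v' \<in> carrier G"
      using that U V sphere_carrier by (auto simp: P_def)
    then show ?thesis using that(3) by simp
  qed
  then have "inj_on (\<lambda>(u, v). (u \<otimes> v, u)) P"
    by (auto simp: inj_on_def)
  then have "card P = card ((\<lambda>(u, v). (u \<otimes> v, u)) ` P)" by (simp add: card_image)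
  also have "\<dots> \<le> card (Sigma (U <#> V) F)"
  proof (rule card_mono)
    show "finite (Sigma (U <#> V) F)"
      using finUV U by (intro finite_SigmaI) (auto simp: F_def)
    show "(\<lambda>(u, v). (u \<otimes> v, u)) ` P \<subseteq> Sigma (U <#> V) F"
      using U V by (auto simp: P_def F_def set_mult_def)
  qed
  also have "\<dots> = (\<Sum>w \<in> U <#> V. card (F w))"
    by (rule card_SigmaI) (use finUV U in \<open>auto simp: F_def\<close>)
  also have "\<dots> \<le> (\<Sum>w \<in> U <#> V. card ?B)"
  proof (rule sum_mono)
    fix w assume "w \<in> U <#> V"
    then have w: "w \<in> carrier G"
      using set_mult_closed[of U V] U(1) V(1) sphere_carrier by blast
    let ?E = "{u \<in> word_sphere G S n. \<exists>v \<in> word_sphere G S k.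
        u \<otimes> v = w \<and> ?N (u0 \<otimes> v) \<le> ?N w}"
    have "word_sphere G S n \<subseteq> word_ball G S (real n)"
      by (auto simp: word_sphere_def word_ball_def)
    then have "finite ?E"
      by (auto intro: finite_subset[OF _ finite_word_ball[OF finS, of "real n"]])
    then have "card (F w) \<le> card ?E" by (auto simp: F_def intro: card_mono)
    also have "\<dots> \<le> card ?B"
      using card_factorisations[OF finS hyp \<open>\<delta> \<ge> 0\<close> _ w] u0 U by blast
    finally show "card (F w) \<le> card ?B" .
  qed
  finally have "card P \<le> card ?B * card (U <#> V)" by (simp add: mult.commute)
  then show ?thesis using half unfolding P_def by linarith
qed

theorem corollary6p8:
  fixes G :: "('a, 'b) monoid_scheme" and S U V :: "'a set"
    and \<delta> :: real and n k :: nat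
  assumes "group G"
    and "finite S" and "S \<subseteq> carrier G"
    and "\<forall>s \<in> S. inv\<^bsub>G\<^esub> s \<in> S"
    and "generate G S = carrier G"
    and "\<delta> \<ge> 0" and "2 * \<delta> \<in> \<int>"
    and "hyperbolic_wrt G S \<delta>"
    and "U \<subseteq> word_sphere G S n" and "finite U" and "U \<noteq> {}"
    and "V \<subseteq> word_sphere G S k" and "finite V" and "V \<noteq> {}"
  shows "real (card (U <#>\<^bsub>G\<^esub> V)) \<ge> growth_const G S \<delta> * real (card U) * real (card V)"
proof -
  interpret symmetric_generators G S
    using assms(1-5) by (simp add: symmetric_generators_def symmetric_generators_axioms_def)
  let ?e = "cayley_parity G S"
  let ?b1 = "card (word_ball G S (4 * \<delta> + ?e))" and ?b2 = "card (word_ball G S (4 * \<delta>))"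
  have e: "?e \<ge> 0" by (simp add: cayley_parity_def)
  \<comment> \<open>Geodesics can be cut at distance \<open>4 \<delta>\<close> because this number is an integer.\<close>
  obtain z :: int where z: "2 * \<delta> = of_int z" using assms(7) by (elim Ints_cases)
  define m where "m = nat (2 * z)"
  have "z \<ge> 0" using z \<open>\<delta> \<ge> 0\<close> by linarith
  then have m: "4 * \<delta> = real m" using z by (simp add: m_def)
  have "card (word_ball G S (8 * \<delta> + ?e)) \<le> ?b2 * ?b1"
  proof -
    have "8 * \<delta> + ?e = real m + (4 * \<delta> + ?e)" using m by simp
    moreover have "4 * \<delta> + ?e \<ge> 0" using e \<open>\<delta> \<ge> 0\<close> by simp
    ultimately show ?thesis
      using card_word_ball_add[OF \<open>finite S\<close>, of "4 * \<delta> + ?e" m] by (simp only: m)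
  qed
  then have "card U * card V \<le> 2 * (?b2 * ?b1 * card (U <#>\<^bsub>G\<^esub> V))"
    using card_set_mult_spheres[OF assms(2) assms(8,6) assms(9-13)]
    by (meson le_trans mult_le_mono le_refl)
  also have "\<dots> \<le> 4 * (?b2 * ?b1 * card (U <#>\<^bsub>G\<^esub> V))" by simp
  finally have "real (card U * card V) \<le> real (4 * (?b2 * ?b1 * card (U <#>\<^bsub>G\<^esub> V)))"
    by (rule of_nat_mono)
  then have "real (card U) * real (card V)
      \<le> 4 * real ?b1 * real ?b2 * real (card (U <#>\<^bsub>G\<^esub> V))"
    by (simp add: algebra_simps)
  moreover have "real ?b1 > 0" "real ?b2 > 0"
    using card_word_ball_pos[OF \<open>finite S\<close>] e \<open>\<delta> \<ge> 0\<close> by simp_all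
  ultimately show ?thesis
    unfolding growth_const_def by (simp add: divide_simps algebra_simps)
qed

end
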